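(* There exist universal constants $c_1,c_2>0$ such that the following holds. Let $\sigma>0$, $F>0$, $A\ge1$, $B>0$, and suppose $Y=f+\xi\in\mathbb R^n$ with $\xi\sim N(0,\sigma^2I_n)$. For all integers $2\le D\le M$ with $D\le n$ and every $s\ge1$, there is a deterministic collection $\mathcal M_0\in\mathbb M^{s}_{M,D,A,B}$ satisfying $$\inf_{\tilde f}\ \sup_{f\in\mathcal F_n(F)}\mathbb P_f\Big[L_n(\tilde f,f)-\inf_{w\in\mathbb R^M}L_n(\hat f_{w|\mathcal M_0},f)\ge c_1\Big\{F^2\wedge\frac{\sigma^2D}{n}\Big\}\Big]\ge c_2,$$ $$\inf_{\tilde f}\ \sup_{f\in\mathcal F_n(F)}\Big\{R_n(\tilde f,f)-\inf_{w\in\mathbb R^M}R_n(\hat f_{w|\mathcal M_0},f)\Big\}\ge c_1\Big\{F^2\wedge\frac{\sigma^2D}{n}\Big\},$$ where the infima over $\tilde f$ are over all estimators $\tilde f=\tilde f(Y)$ based on $Y$.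
   Context: $f\in\mathbb R^n$ is an unknown deterministic mean vector; $\mathbb P_f,\mathbb E_f$ refer to the law of $Y=f+\xi$. $\|\cdot\|$ is the Euclidean norm, $\|v\|_n^2=\frac1n\|v\|^2$, $\|\cdot\|_{\mathrm{op}}$ the operator norm, $\|\cdot\|_{\mathrm F}$ the Frobenius norm, $a\wedge b=\min\{a,b\}$. $\mathcal F_n(F)=\{f\in\mathbb R^n:\|f\|_n\le F\}$. An estimator is a measurable $\mathbb R^n$-valued function of $Y$. Loss: $L_n(\hat f,f)=\|\hat f-f\|_n^2$; risk: $R_n(\hat f,f)=\mathbb E_f\|\hat f-f\|_n^2$. For a collection $\mathcal M=\{(A_j,b_j)\}_{j=1}^M$ of $M$ pairs (repetitions allowed) with $A_j\in\mathbb R^{n\times n}$, $b_j\in\mathbb R^n$ deterministic, and $w\in\mathbb R^M$, put $A_w=\sum_jw_jA_j$, $b_w=\sum_jw_jb_j$, $\hat f_{w|\mathcal M}=A_wY+b_w$. Let $\mathcal V(\mathcal M)=\{(A_w,b_w):w\in\mathbb R^M\}\subseteq\mathbb R^{n\times n}\times\mathbb R^n$, $D(\mathcal M)=\dim\mathcal V(\mathcal M)$, and $\mathcal A(\mathcal M)=\{A'\in\mathbb R^{n\times n}:(A',b')\in\mathcal V(\mathcal M)\text{ for some }b'\in\mathbb R^n\}$. The stable rank of a nonzero matrix $A'$ is $\operatorname{sr}(A')=\|A'\|_{\mathrm F}^2/\|A'\|_{\mathrm{op}}^2$, and the minimum stable rank is $s_{\mathcal A}(\mathcal M)=\inf\{\operatorname{sr}(A'):A'\in\mathcal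 A(\mathcal M),\,A'\ne0\}$, with $s_{\mathcal A}(\mathcal M)=+\infty$ if $\mathcal A(\mathcal M)=\{0\}$. Finally, $\mathbb M^{s}_{M,D,A,B}$ is the set of collections $\mathcal M$ of $M$ pairs with $\max_j\|A_j\|_{\mathrm{op}}\le A$, $\max_j\|b_j\|_n\le B$, $D(\mathcal M)=D$ and $s_{\mathcal A}(\mathcal M)\ge s$. *)

theory Defs
  imports "HOL-Probability.Probability" "HOL-Library.Function_Algebras"
begin

text \<open>
  Since the constants of the theorem must not depend on the dimension, \<open>n\<close> is a
  natural number rather than a type. Means, observations and estimates are points of
  the product space \<open>\<real>\<^sup>n\<close> indexed by \<open>{..<n}\<close>. The coefficients
  \<open>A\<^sub>j\<close>, \<open>b\<^sub>j\<close> of affine estimators must instead live in a vector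
  space, so they are functions on \<open>nat\<close> that vanish outside the index range; the
  library's linear combinations and \<open>dim\<close> then apply to them through the pointwise
  vector space structure on functions, which is set up first.
\<close>

instantiation "fun" :: (type, real_vector) real_vector
begin

definition scaleR_fun :: "real \<Rightarrow> ('a \<Rightarrow> 'b) \<Rightarrow> 'a \<Rightarrow> 'b"
  where "scaleR_fun r f = (\<lambda>x. r *\<^sub>R f x)"

instance
  by standard
    (auto simp: scaleR_fun_def fun_eq_iff scaleR_add_right scaleR_add_left)

end

lemma scaleR_fun_apply [simp]: "(r *\<^sub>R f) x = r *\<^sub>R f x"
  by (simp add: scaleR_fun_def)

abbreviation Rn :: "nat \<Rightarrow> (nat \<Rightarrow> real) measure"
  where "Rn n \<equiv> Pi\<^sub>M {..<n} (\<lambda>_. borel)"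

definition enorm :: "nat \<Rightarrow> (nat \<Rightarrow> real) \<Rightarrow> real"
  where "enorm n v = L2_set v {..<n}"

definition norm_n :: "nat \<Rightarrow> (nat \<Rightarrow> real) \<Rightarrow> real"
  where "norm_n n v = sqrt ((enorm n v)\<^sup>2 / real n)"

definition mean_ball :: "nat \<Rightarrow> real \<Rightarrow> (nat \<Rightarrow> real) set"
  where "mean_ball n F = {f \<in> space (Rn n). norm_n n f \<le> F}"

definition gaussian_noise :: "nat \<Rightarrow> real \<Rightarrow> (nat \<Rightarrow> real) measure"
  where "gaussian_noise n \<sigma> = Pi\<^sub>M {..<n} (\<lambda>_. density lborel (normal_density 0 \<sigma>))"

definition obs_law :: "nat \<Rightarrow> real \<Rightarrow> (nat \<Rightarrow> real) \<Rightarrow> (nat \<Rightarrow> real) measure"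
  where "obs_law n \<sigma> f =
    distr (gaussian_noise n \<sigma>) (Rn n) (\<lambda>\<xi>. \<lambda>i\<in>{..<n}. f i + \<xi> i)"

definition estimators :: "nat \<Rightarrow> ((nat \<Rightarrow> real) \<Rightarrow> nat \<Rightarrow> real) set"
  where "estimators n = measurable (Rn n) (Rn n)"

definition loss :: "nat \<Rightarrow> (nat \<Rightarrow> real) \<Rightarrow> (nat \<Rightarrow> real) \<Rightarrow> real"
  where "loss n g f = (norm_n n (\<lambda>i. g i - f i))\<^sup>2"

text \<open>The risk is an extended real: it may be infinite for a general estimator.\<close>

definition risk ::
  "nat \<Rightarrow> real \<Rightarrow> ((nat \<Rightarrow> real) \<Rightarrow> nat \<Rightarrow> real) \<Rightarrow> (nat \<Rightarrow> real) \<Rightarrow> ereal"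
  where "risk n \<sigma> g f = enn2ereal (\<integral>\<^sup>+ y. ennreal (loss n (g y) f) \<partial>obs_law n \<sigma> f)"

type_synonym matrix = "nat \<Rightarrow> nat \<Rightarrow> real"

type_synonym affine = "matrix \<times> (nat \<Rightarrow> real)"

definition matrices :: "nat \<Rightarrow> matrix set"
  where "matrices n = {A. \<forall>i k. \<not> (i < n \<and> k < n) \<longrightarrow> A i k = 0}"

definition vectors :: "nat \<Rightarrow> (nat \<Rightarrow> real) set"
  where "vectors n = {b. \<forall>i. \<not> i < n \<longrightarrow> b i = 0}"

definition mat_vec :: "nat \<Rightarrow> matrix \<Rightarrow> (nat \<Rightarrow> real) \<Rightarrow> nat \<Rightarrow> real"
  where "mat_vec n A x = (\<lambda>i. \<Sum>k<n. A i k * x k)"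

text \<open>As in \<open>onorm\<close>, the quotient at \<open>x = 0\<close> is \<open>0\<close>.\<close>

definition op_norm :: "nat \<Rightarrow> matrix \<Rightarrow> real"
  where "op_norm n A = (SUP x \<in> space (Rn n). enorm n (mat_vec n A x) / enorm n x)"

definition frobenius_norm :: "nat \<Rightarrow> matrix \<Rightarrow> real"
  where "frobenius_norm n A = L2_set (\<lambda>(i, k). A i k) ({..<n} \<times> {..<n})"

text \<open>
  A collection of \<open>M\<close> pairs is a list of length \<open>M\<close>. Weights are functions
  \<open>w\<close> on \<open>nat\<close>, of which only the values at \<open>j < M\<close> are used.
\<close>

definition combine :: "affine list \<Rightarrow> (nat \<Rightarrow> real) \<Rightarrow> affine"
  where "combine \<M> w = (\<Sum>j<length \<M>. w j *\<^sub>R \<M> ! j)"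

definition affine_est ::
  "nat \<Rightarrow> affine list \<Rightarrow> (nat \<Rightarrow> real) \<Rightarrow> (nat \<Rightarrow> real) \<Rightarrow> nat \<Rightarrow> real"
  where "affine_est n \<M> w y =
    (\<lambda>i\<in>{..<n}. mat_vec n (fst (combine \<M> w)) y i + snd (combine \<M> w) i)"

definition coeff_space :: "affine list \<Rightarrow> affine set"
  where "coeff_space \<M> = {combine \<M> w | w. True}"

definition matrix_space :: "affine list \<Rightarrow> matrix set"
  where "matrix_space \<M> = {A. \<exists>b. (A, b) \<in> coeff_space \<M>}"

definition stable_rank :: "nat \<Rightarrow> matrix \<Rightarrow> real"
  where "stable_rank n A = (frobenius_norm n A)\<^sup>2 / (op_norm n A)\<^sup>2"

text \<open>The infimum of the empty set is \<open>\<infinity>\<close> in \<^typ>\<open>ereal\<close>.\<close>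

definition min_stable_rank :: "nat \<Rightarrow> affine list \<Rightarrow> ereal"
  where "min_stable_rank n \<M> = (INF A \<in> matrix_space \<M> - {0}. ereal (stable_rank n A))"

definition collections ::
  "nat \<Rightarrow> real \<Rightarrow> nat \<Rightarrow> nat \<Rightarrow> real \<Rightarrow> real \<Rightarrow> affine list set"
  where "collections n s M D A B = {\<M>. length \<M> = M \<and>
    set \<M> \<subseteq> matrices n \<times> vectors n \<and>
    (\<forall>(A\<^sub>j, b\<^sub>j) \<in> set \<M>. op_norm n A\<^sub>j \<le> A \<and> norm_n n b\<^sub>j \<le> B) \<and>
    dim (coeff_space \<M>) = D \<and> min_stable_rank n \<M> \<ge> ereal s}"

end

theory Submission
  imports Defs
begin

text \<open>
  Take all matrices to be zero and let the vectors be multiples of \<open>e\<^sub>0, \<dots>, e\<^sub>D\<^sub>-\<^sub>1\<close>,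
  padded by zeros: the minimum stable rank is then infinite, and every mean in the span of these
  vectors has oracle loss and oracle risk zero. It remains to bound the minimax loss
  over the \<open>2\<^sup>D\<close> points \<open>(\<plusminus>\<delta>, \<dots>, \<plusminus>\<delta>, 0, \<dots>, 0)\<close> with
  \<open>\<delta>\<^sup>2 D / n = min F\<^sup>2 (\<sigma>\<^sup>2 D / n)\<close>, so that \<open>\<delta> \<le> \<sigma>\<close>. Averaged over these points, an
  estimator gets the sign of each coordinate wrong with at least a constant
  probability (Assouad). For some point, the expected number of wrong signs is therefore at least a
  constant multiple of \<open>D\<close>; as this number never exceeds \<open>D\<close>, it is of order \<open>D\<close> with constant
  probability. The bound in risk follows by Markov's inequality.
\<close>

section \<open>The law of the observation as a product of normal laws\<close>

lemma distr_normal_shift: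
  fixes c \<sigma> :: real
  assumes "\<sigma> > 0"
  shows "distr (density lborel (normal_density 0 \<sigma>)) borel (\<lambda>x. c + x) =
    density lborel (normal_density c \<sigma>)"
proof -
  interpret prob_space "density lborel (normal_density 0 \<sigma>)"
    using assms by (rule prob_space_normal_density)
  have "distributed (density lborel (normal_density 0 \<sigma>)) lborel (\<lambda>x. x) (normal_density 0 \<sigma>)"
    unfolding distributed_def by (auto simp: distr_id2)
  from normal_density_affine[OF this assms, of 1 c] show ?thesis
    by (simp add: distributed_def cong: distr_cong)
qed

text \<open>Adding \<open>f\<close> acts on each coordinate separately, so the preimage of a box is
  the box with translated sides, and a product measure is determined by its values on boxes. The
  product form is what later allows a single coordinate to be integrated separately.\<close>

lemma obs_law_eq_PiM:
  assumes "\<sigma> > 0"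
  shows "obs_law n \<sigma> f = Pi\<^sub>M {..<n} (\<lambda>i. density lborel (normal_density (f i) \<sigma>))"
proof -
  let ?N = "\<lambda>i. density lborel (normal_density (f i) \<sigma>)"
  let ?Z = "\<lambda>_::nat. density lborel (normal_density 0 \<sigma>)"
  have "prob_space (?N i)" "prob_space (?Z i)" for i
    using assms by (simp_all add: prob_space_normal_density)
  then interpret N: product_prob_space ?N + Z: product_prob_space ?Z
    by (auto intro!: product_prob_spaceI)
  have sets: "sets (Pi\<^sub>M {..<n} ?Z) = sets (Rn n)" "sets (Pi\<^sub>M {..<n} ?N) = sets (Rn n)"
    by (auto intro!: sets_PiM_cong)
  have meas: "(\<lambda>\<xi>. \<lambda>i\<in>{..<n}. f i + \<xi> i) \<in> measurable (Pi\<^sub>M {..<n} ?Z) (Rn n)"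
    by (subst measurable_cong_sets[OF sets(1) refl]) measurable
  show ?thesis
    unfolding obs_law_def gaussian_noise_def
  proof (rule N.PiM_eqI)
    show "sets (distr (Pi\<^sub>M {..<n} ?Z) (Rn n) (\<lambda>\<xi>. \<lambda>i\<in>{..<n}. f i + \<xi> i)) = sets (Pi\<^sub>M {..<n} ?N)"
      by (simp add: sets)
  next
    fix X assume "\<And>i. i \<in> {..<n} \<Longrightarrow> X i \<in> sets (?N i)"
    then have X: "\<And>i. i < n \<Longrightarrow> X i \<in> sets borel" by simp
    have "(\<lambda>\<xi>. \<lambda>i\<in>{..<n}. f i + \<xi> i) -` Pi\<^sub>E {..<n} X \<inter> space (Pi\<^sub>M {..<n} ?Z) =
        Pi\<^sub>E {..<n} (\<lambda>i. (\<lambda>x. f i + x) -` X i)"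
      by (auto simp: space_PiM PiE_iff)
    then have "emeasure (distr (Pi\<^sub>M {..<n} ?Z) (Rn n) (\<lambda>\<xi>. \<lambda>i\<in>{..<n}. f i + \<xi> i)) (Pi\<^sub>E {..<n} X) =
        emeasure (Pi\<^sub>M {..<n} ?Z) (Pi\<^sub>E {..<n} (\<lambda>i. (\<lambda>x. f i + x) -` X i))"
      using X by (subst emeasure_distr[OF meas]) (auto intro!: sets_PiM_I_finite)
    also have "\<dots> = (\<Prod>i<n. emeasure (?Z i) ((\<lambda>x. f i + x) -` X i))"
    proof (rule Z.emeasure_PiM)
      fix i assume "i \<in> {..<n}"
      then have "(\<lambda>x. f i + x) -` X i \<inter> space borel \<in> sets borel"
        using X by (intro measurable_sets[of _ borel borel]) auto
      then show "(\<lambda>x. f i + x) -` X i \<in> sets (?Z i)" by simp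
    qed simp
    also have "\<dots> = (\<Prod>i<n. emeasure (?N i) (X i))"
    proof (rule prod.cong[OF refl])
      fix i assume "i \<in> {..<n}"
      then show "emeasure (?Z i) ((\<lambda>x. f i + x) -` X i) = emeasure (?N i) (X i)"
        using X assms by (subst distr_normal_shift[symmetric]) (simp_all add: emeasure_distr)
    qed
    finally show "emeasure (distr (Pi\<^sub>M {..<n} ?Z) (Rn n) (\<lambda>\<xi>. \<lambda>i\<in>{..<n}. f i + \<xi> i)) (Pi\<^sub>E {..<n} X) =
        (\<Prod>i\<in>{..<n}. emeasure (?N i) (X i))" .
  qed simp
qed

lemma prob_space_obs_law: "\<sigma> > 0 \<Longrightarrow> prob_space (obs_law n \<sigma> f)"
  by (auto simp: obs_law_eq_PiM intro!: prob_space_PiM prob_space_normal_density)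

lemma sets_obs_law [simp]: "sets (obs_law n \<sigma> f) = sets (Rn n)"
  and space_obs_law [simp]: "space (obs_law n \<sigma> f) = space (Rn n)"
  by (simp_all add: obs_law_def)

section \<open>Testing between two means that differ in one coordinate\<close>

text \<open>
  All normal densities with standard deviation \<open>\<sigma>\<close> and mean in \<open>[-\<sigma>, \<sigma>]\<close> are at least
  \<open>overlap / \<sigma>\<close> on \<open>[-\<sigma>, \<sigma>]\<close>; this common part has mass \<open>2 * overlap\<close>.
\<close>

definition overlap :: real
  where "overlap = exp (- 2) / sqrt (2 * pi)"

lemma overlap_pos: "overlap > 0"
  by (simp add: overlap_def)

lemma overlap_le_1: "overlap \<le> 1"
proof -
  have "1 \<le> sqrt (2 * pi)" using pi_ge_two by simp
  moreover have "exp (- 2) \<le> (1 :: real)" by simp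
  ultimately have "exp (- 2) \<le> sqrt (2 * pi)" by linarith
  then show ?thesis by (simp add: overlap_def)
qed

text \<open>The distance from \<open>x\<close> to \<open>\<mu>\<close> is at most
  \<open>2 * \<sigma>\<close>, so the exponent is at least
  \<open>- (2 * \<sigma>)\<^sup>2 / (2 * \<sigma>\<^sup>2)\<close>, which is the -2 in
  \<open>overlap\<close>.\<close>

lemma normal_density_ge_overlap:
  assumes "\<sigma> > 0" "\<bar>\<mu>\<bar> \<le> \<sigma>" "\<bar>x\<bar> \<le> \<sigma>"
  shows "normal_density \<mu> \<sigma> x \<ge> overlap / \<sigma>"
proof -
  have "(x - \<mu>)\<^sup>2 \<le> (2 * \<sigma>)\<^sup>2"
    using assms by (intro power2_le_iff_abs_le[THEN iffD2]) auto
  then have "exp (- 2) \<le> exp (- (x - \<mu>)\<^sup>2 / (2 * \<sigma>\<^sup>2))"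
    using assms by (simp add: field_simps)
  then show ?thesis
    using assms by (simp add: overlap_def normal_density_def real_sqrt_mult field_simps)
qed

text \<open>Each point lies in \<open>T\<close> or in its complement and so contributes one of the
  two densities. On an interval of length \<open>2 * \<sigma>\<close> either density is at least
  \<open>overlap / \<sigma>\<close>. Read \<open>T\<close> as the region where a test rejects mean
  \<open>\<mu>\<close>: its two error probabilities cannot both be small.\<close>

lemma normal_two_point:
  assumes \<sigma>: "\<sigma> > 0" and \<mu>: "\<bar>\<mu>\<bar> \<le> \<sigma>" and \<nu>: "\<bar>\<nu>\<bar> \<le> \<sigma>"
    and T [measurable]: "T \<in> sets borel"
  shows "emeasure (density lborel (normal_density \<mu> \<sigma>)) T +
    emeasure (density lborel (normal_density \<nu> \<sigma>)) (- T) \<ge> ennreal (2 * overlap)"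
proof -
  let ?m = "\<lambda>x. ennreal (overlap / \<sigma>) * indicator {- \<sigma>..\<sigma>} x"
  have "ennreal (2 * overlap) = (\<integral>\<^sup>+ x. ?m x \<partial>lborel)"
    using \<sigma> overlap_pos by (simp add: nn_integral_cmult ennreal_mult[symmetric])
  also have "\<dots> \<le> (\<integral>\<^sup>+ x. ennreal (normal_density \<mu> \<sigma> x) * indicator T x +
      ennreal (normal_density \<nu> \<sigma> x) * indicator (- T) x \<partial>lborel)"
    using normal_density_ge_overlap[OF \<sigma> \<mu>] normal_density_ge_overlap[OF \<sigma> \<nu>]
    by (intro nn_integral_mono) (auto intro!: ennreal_leI split: split_indicator)
  also have "\<dots> = emeasure (density lborel (normal_density \<mu> \<sigma>)) T +
      emeasure (density lborel (normal_density \<nu> \<sigma>)) (- T)"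
    by (subst nn_integral_add) (auto simp: emeasure_density)
  finally show ?thesis .
qed

lemma obs_law_two_point:
  assumes \<sigma>: "\<sigma> > 0" and i: "i < n" and f: "\<bar>f i\<bar> \<le> \<sigma>" and g: "\<bar>g i\<bar> \<le> \<sigma>"
    and eq: "\<And>k. k < n \<Longrightarrow> k \<noteq> i \<Longrightarrow> f k = g k"
    and S: "S \<in> sets (Rn n)"
  shows "measure (obs_law n \<sigma> f) S + measure (obs_law n \<sigma> g) (space (Rn n) - S) \<ge> 2 * overlap"
proof -
  define J where "J = {..<n} - {i}"
  have J: "finite J" "i \<notin> J" and ins: "{..<n} = insert i J"
    using i by (auto simp: J_def)
  let ?N = "\<lambda>h i. density lborel (normal_density (h i) \<sigma>)"
  \<comment> \<open>The joint law of the coordinates other than \<open>i\<close>, which is the same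
    under \<open>f\<close> and \<open>g\<close>.\<close>
  define P where "P = Pi\<^sub>M J (?N f)"
  have P': "P = Pi\<^sub>M J (?N g)"
    unfolding P_def by (rule PiM_cong) (auto simp: J_def eq)
  have "prob_space (?N h i)" for h :: "nat \<Rightarrow> real" and i
    using \<sigma> by (simp add: prob_space_normal_density)
  then have pN: "product_prob_space (?N h)" for h :: "nat \<Rightarrow> real"
    by (auto intro!: product_prob_spaceI)
  interpret P: prob_space P
    unfolding P_def using \<sigma> by (auto intro!: prob_space_PiM prob_space_normal_density)
  have sP: "sets P = sets (Pi\<^sub>M J (\<lambda>_. borel))"
    unfolding P_def by (auto intro!: sets_PiM_cong)
  have meas2: "(\<lambda>(x, t). x(i := t)) \<in> measurable (P \<Otimes>\<^sub>M borel) (Pi\<^sub>M (insert i J) (\<lambda>_. borel))"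
    unfolding measurable_cong_sets[OF sets_pair_measure_cong[OF sP refl] refl]
    by (simp add: split_beta' measurable_add_dim[unfolded split_beta'])
  \<comment> \<open>Fubini with coordinate \<open>i\<close> innermost: the probability of
    \<open>U\<close> is the average over \<open>P\<close> of the mass of its slices.\<close>
  have split: "emeasure (obs_law n \<sigma> h) U =
      (\<integral>\<^sup>+ x. emeasure (?N h i) {t. x(i := t) \<in> U} \<partial>P)"
    if U: "U \<in> sets (Rn n)" and h: "P = Pi\<^sub>M J (?N h)" for h U
  proof -
    interpret Nh: product_prob_space "?N h" by (rule pN)
    have U': "U \<in> sets (Pi\<^sub>M (insert i J) (?N h))"
      using U unfolding ins by (simp cong: sets_PiM_cong)
    have "emeasure (obs_law n \<sigma> h) U = (\<integral>\<^sup>+ y. indicator U y \<partial>Pi\<^sub>M (insert i J) (?N h))"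
      using U' \<sigma> by (simp add: obs_law_eq_PiM ins)
    also have "\<dots> = (\<integral>\<^sup>+ x. (\<integral>\<^sup>+ t. indicator U (x(i := t)) \<partial>?N h i) \<partial>P)"
      unfolding h using J U' by (subst Nh.product_nn_integral_insert) auto
    also have "\<dots> = (\<integral>\<^sup>+ x. emeasure (?N h i) {t. x(i := t) \<in> U} \<partial>P)"
    proof (rule nn_integral_cong)
      fix x assume x: "x \<in> space P"
      have "(\<lambda>t. x(i := t)) \<in> measurable borel (Rn n)"
        using measurable_compose[OF measurable_Pair1'[OF x] meas2] ins by simp
      then have "(\<lambda>t. x(i := t)) -` U \<inter> space borel \<in> sets borel"
        using U by (rule measurable_sets)
      then have "{t. x(i := t) \<in> U} \<in> sets (?N h i)" by (simp add: vimage_def)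
      then show "(\<integral>\<^sup>+ t. indicator U (x(i := t)) \<partial>?N h i) = emeasure (?N h i) {t. x(i := t) \<in> U}"
        using nn_integral_indicator[of "{t. x(i := t) \<in> U}" "?N h i"] by (simp add: indicator_def)
    qed
    finally show ?thesis .
  qed
  have slice_meas: "{z \<in> space (P \<Otimes>\<^sub>M borel). (fst z)(i := snd z) \<in> U} \<in> sets (P \<Otimes>\<^sub>M borel)"
    if "U \<in> sets (Rn n)" for U
    using measurable_sets[OF meas2, of U] that unfolding ins
    by (simp add: vimage_def split_beta' Int_def conj_commute)
  have em: "(\<lambda>x. emeasure (?N h i) {t. x(i := t) \<in> U}) \<in> borel_measurable P"
    if U: "U \<in> sets (Rn n)" for h U
  proof -
    interpret N: prob_space "?N h i" using \<sigma> by (simp add: prob_space_normal_density)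
    have "sets (P \<Otimes>\<^sub>M ?N h i) = sets (P \<Otimes>\<^sub>M borel)" by (rule sets_pair_measure_cong) auto
    then have "{z \<in> space (P \<Otimes>\<^sub>M borel). (fst z)(i := snd z) \<in> U} \<in> sets (P \<Otimes>\<^sub>M ?N h i)"
      using slice_meas[OF U] by simp
    from N.measurable_emeasure_Pair[OF this] show ?thesis
      by (rule measurable_cong[THEN iffD1, rotated])
        (auto simp: space_pair_measure intro!: arg_cong[where f="emeasure _"])
  qed
  let ?U = "space (Rn n) - S"
  have U: "?U \<in> sets (Rn n)" using S by auto
  have "ennreal (2 * overlap) = (\<integral>\<^sup>+ x. ennreal (2 * overlap) \<partial>P)"
    using P.emeasure_space_1 by simp
  also have "\<dots> \<le> (\<integral>\<^sup>+ x. emeasure (?N f i) {t. x(i := t) \<in> S} +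
      emeasure (?N g i) {t. x(i := t) \<in> ?U} \<partial>P)"
  proof (rule nn_integral_mono)
    fix x assume x: "x \<in> space P"
    have m: "(\<lambda>t. x(i := t)) \<in> measurable borel (Rn n)"
      using measurable_compose[OF measurable_Pair1'[OF x] meas2] ins by simp
    then have "(\<lambda>t. x(i := t)) -` S \<inter> space borel \<in> sets borel"
      using S by (rule measurable_sets)
    then have T: "{t. x(i := t) \<in> S} \<in> sets borel" by (simp add: vimage_def)
    \<comment> \<open>\<open>x(i := t)\<close> lies in \<open>space (Rn n)\<close> for every
      \<open>t\<close>, so the relative complement of \<open>S\<close> slices to a full complement
      in the line.\<close>
    have "{t. x(i := t) \<in> ?U} = - {t. x(i := t) \<in> S}"
      using measurable_space[OF m] by auto
    then show "ennreal (2 * overlap) \<le> emeasure (?N f i) {t. x(i := t) \<in> S} +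
      emeasure (?N g i) {t. x(i := t) \<in> ?U}"
      using normal_two_point[OF \<sigma> f g T] by simp
  qed
  also have "\<dots> = emeasure (obs_law n \<sigma> f) S + emeasure (obs_law n \<sigma> g) ?U"
    using split[OF S P_def] split[OF U P'] em[OF S, of f] em[OF U, of g] by (simp add: nn_integral_add)
  finally have *: "ennreal (2 * overlap) \<le> emeasure (obs_law n \<sigma> f) S + emeasure (obs_law n \<sigma> g) ?U" .
  interpret f: prob_space "obs_law n \<sigma> f" using \<sigma> by (rule prob_space_obs_law)
  interpret g: prob_space "obs_law n \<sigma> g" using \<sigma> by (rule prob_space_obs_law)
  from * show ?thesis
    by (simp add: f.emeasure_eq_measure g.emeasure_eq_measure ennreal_plus[symmetric] del: ennreal_plus)
qed


section \<open>From a large expected count to a large count with constant probability\<close>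

text \<open>Let \<open>G\<close> be the event in the conclusion. The count is at most
  \<open>card I\<close> on \<open>G\<close> and at most \<open>p / 2 * card I\<close> off it; its
  expectation is at least \<open>p * card I\<close>, so \<open>G\<close> must supply the missing
  half.\<close>

lemma (in prob_space) reverse_Markov_count:
  assumes p: "p \<ge> 0" and I: "finite I" "I \<noteq> {}" and E: "\<And>i. i \<in> I \<Longrightarrow> E i \<in> events"
    and sum: "(\<Sum>i\<in>I. prob (E i)) \<ge> p * real (card I)"
  shows "\<P>(x in M. real (card {i \<in> I. x \<in> E i}) \<ge> p / 2 * real (card I)) \<ge> p / 2"
proof -
  let ?c = "real (card I)" and ?N = "\<lambda>x. \<Sum>i\<in>I. indicator (E i) x :: real"
  have N: "real (card {i \<in> I. x \<in> E i}) = ?N x" for x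
    using I by (simp add: indicator_def sum.If_cases Int_def)
  define G where "G = {x \<in> space M. ?N x \<ge> p / 2 * ?c}"
  have [measurable]: "?N \<in> borel_measurable M" using E by measurable
  have G [measurable]: "G \<in> events" unfolding G_def by measurable
  have int: "integrable M (\<lambda>x. indicator (E i) x :: real)" if "i \<in> I" for i
    using E[OF that] by (simp add: integrable_real_indicator emeasure_eq_measure)
  have "p * ?c \<le> (\<Sum>i\<in>I. prob (E i))" by (rule sum)
  also have "\<dots> = expectation ?N"
    using E int by (subst Bochner_Integration.integral_sum) (auto simp: sets.Int_space_eq2)
  also have "\<dots> \<le> expectation (\<lambda>x. ?c * indicator G x + p / 2 * ?c)"
  proof (rule integral_mono)
    fix x assume x: "x \<in> space M"
    have "?N x \<le> (\<Sum>i\<in>I. 1)" by (rule sum_mono) (simp add: indicator_def)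
    moreover have "0 \<le> p / 2 * ?c" using p by simp
    moreover have "x \<notin> G \<Longrightarrow> ?N x \<le> p / 2 * ?c" using x by (simp add: G_def)
    ultimately show "?N x \<le> ?c * indicator G x + p / 2 * ?c"
      by (cases "x \<in> G") auto
  qed (use int in \<open>auto simp: integrable_real_indicator emeasure_eq_measure\<close>)
  also have "\<dots> = ?c * prob G + p / 2 * ?c"
    by (subst Bochner_Integration.integral_add)
      (auto simp: integrable_real_indicator emeasure_eq_measure prob_space)
  finally have "?c * (p / 2) \<le> ?c * prob G" by (simp add: algebra_simps)
  moreover have "?c > 0" using I by (simp add: card_gt_0_iff)
  ultimately show ?thesis unfolding G_def N by (simp add: mult_le_cancel_left_pos)
qed

section \<open>Assouad's argument on the hypercube of means\<close>

text \<open>A sign pattern is encoded as the set of its positive coordinates, so that changing one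
  sign is inserting or removing one element. The outer restriction makes the vertex a point of
  \<open>space (Rn n)\<close>.\<close>

definition cube_point :: "nat \<Rightarrow> nat \<Rightarrow> real \<Rightarrow> nat set \<Rightarrow> nat \<Rightarrow> real"
  where "cube_point n D \<delta> S = (\<lambda>i\<in>{..<n}. if i < D then (if i \<in> S then \<delta> else - \<delta>) else 0)"

lemma norm_n_squared: "(norm_n n v)\<^sup>2 = (\<Sum>i<n. (v i)\<^sup>2) / real n"
  by (simp add: norm_n_def enorm_def L2_set_def sum_nonneg)

lemma loss_eq: "loss n v f = (\<Sum>i<n. (v i - f i)\<^sup>2) / real n"
  by (simp add: loss_def norm_n_squared)

lemma loss_nonneg: "0 \<le> loss n v f"
  by (simp add: loss_def)

lemma borel_measurable_estimator_component:
  assumes "g \<in> estimators n" "i < n"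
  shows "(\<lambda>y. g y i) \<in> borel_measurable (Rn n)"
  using assms unfolding estimators_def by (auto intro: measurable_compose measurable_component_singleton)

lemma borel_measurable_loss:
  assumes "g \<in> estimators n"
  shows "(\<lambda>y. loss n (g y) f) \<in> borel_measurable (Rn n)"
  unfolding loss_eq using borel_measurable_estimator_component[OF assms] by measurable

text \<open>When \<open>v i\<close> has the wrong sign, zero counting as positive, it is separated
  by 0 from the true value \<delta> or -\<delta>, so this coordinate alone costs at least
  \<open>\<delta>\<^sup>2\<close>.\<close>

lemma loss_cube_point_ge:
  assumes "D \<le> n" "\<delta> > 0"
  shows "loss n v (cube_point n D \<delta> S) \<ge> \<delta>\<^sup>2 / real n * real (card {i \<in> {..<D}. (0 \<le> v i) \<noteq> (i \<in> S)})"
proof -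
  let ?H = "{i \<in> {..<D}. (0 \<le> v i) \<noteq> (i \<in> S)}"
  have "(\<Sum>i\<in>?H. \<delta>\<^sup>2) \<le> (\<Sum>i\<in>?H. (v i - cube_point n D \<delta> S i)\<^sup>2)"
  proof (rule sum_mono)
    fix i assume "i \<in> ?H"
    then show "\<delta>\<^sup>2 \<le> (v i - cube_point n D \<delta> S i)\<^sup>2"
      using assms by (intro abs_le_square_iff[THEN iffD1]) (auto simp: cube_point_def)
  qed
  also have "\<dots> \<le> (\<Sum>i<n. (v i - cube_point n D \<delta> S i)\<^sup>2)"
    using assms by (intro sum_mono2) auto
  finally show ?thesis
    by (simp add: loss_eq divide_right_mono mult.commute)
qed

text \<open>\<open>E i\<close> is the event that sign \<open>i\<close> is declared positive. For
  each \<open>i\<close>, vertices are paired along the edges in direction \<open>i\<close>, and the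
  two-point bound holds on every edge. Averaging over all vertices and summing over \<open>i\<close>
  leaves one vertex at least as bad as the average.\<close>

lemma cube_testing_bound:
  assumes \<sigma>: "\<sigma> > 0" and \<delta>: "\<delta> > 0" "\<delta> \<le> \<sigma>" and D: "0 < D" "D \<le> n"
    and E: "\<And>i. i < D \<Longrightarrow> E i \<in> sets (Rn n)"
  obtains S where "(\<Sum>i<D. measure (obs_law n \<sigma> (cube_point n D \<delta> S))
    {y \<in> space (Rn n). (y \<in> E i) \<noteq> (i \<in> S)}) \<ge> overlap * real D"
proof -
  define X where "X i S = measure (obs_law n \<sigma> (cube_point n D \<delta> S))
    {y \<in> space (Rn n). (y \<in> E i) \<noteq> (i \<in> S)}" for i S
  define flip where "flip i S = (if i \<in> S then S - {i} else insert i S)" for i :: nat and S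
  let ?P = "Pow {..<D}"
  \<comment> \<open>Flipping sign \<open>i\<close> turns the error event into its complement and
    changes the mean in coordinate \<open>i\<close> only; \<open>\<delta> \<le> \<sigma>\<close>
    puts both values in the range of the two-point bound.\<close>
  have pair: "X i S + X i (flip i S) \<ge> 2 * overlap" if i: "i < D" for i S
  proof -
    let ?T = "{y \<in> space (Rn n). (y \<in> E i) \<noteq> (i \<in> S)}"
    have "{y \<in> space (Rn n). (y \<in> E i) \<noteq> (i \<in> flip i S)} = space (Rn n) - ?T"
      by (auto simp: flip_def)
    moreover have "?T \<in> sets (Rn n)"
    proof (cases "i \<in> S")
      case True
      then have "?T = space (Rn n) - E i" by auto
      then show ?thesis using E[OF i] by auto
    next
      case False
      then have "?T = E i" using sets.sets_into_space[OF E[OF i]] by auto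
      then show ?thesis using E[OF i] by simp
    qed
    ultimately show ?thesis
      unfolding X_def using \<sigma> \<delta> D i
      by (simp, intro obs_law_two_point[where i = i]) (auto simp: cube_point_def flip_def)
  qed
  \<comment> \<open>The flip is an involution of the vertex set, so the sum over pairs counts every
    vertex twice.\<close>
  have half: "(\<Sum>S\<in>?P. X i S) \<ge> overlap * 2 ^ D" if i: "i < D" for i
  proof -
    have "(\<Sum>S\<in>?P. X i (flip i S)) = (\<Sum>S\<in>?P. X i S)"
      using i by (intro sum.reindex_bij_witness[of _ "flip i" "flip i"]) (auto simp: flip_def)
    then have "2 * (\<Sum>S\<in>?P. X i S) = (\<Sum>S\<in>?P. X i S + X i (flip i S))"
      by (simp add: sum.distrib)
    also have "\<dots> \<ge> (\<Sum>S\<in>?P. 2 * overlap)"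
      using pair[OF i] by (rule sum_mono)
    finally show ?thesis by (simp add: card_Pow mult.commute)
  qed
  have "\<exists>S\<in>?P. (\<Sum>i<D. X i S) \<ge> overlap * real D"
  proof (rule ccontr)
    assume "\<not> ?thesis"
    then have "(\<Sum>S\<in>?P. \<Sum>i<D. X i S) < (\<Sum>S\<in>?P. overlap * real D)"
      by (intro sum_strict_mono) (auto simp: not_le)
    also have "\<dots> = (\<Sum>i<D. overlap * 2 ^ D)" by (simp add: card_Pow)
    also have "\<dots> \<le> (\<Sum>i<D. \<Sum>S\<in>?P. X i S)" using half by (intro sum_mono) auto
    also have "\<dots> = (\<Sum>S\<in>?P. \<Sum>i<D. X i S)" by (rule sum.swap)
    finally show False by simp
  qed
  then show ?thesis using that unfolding X_def by blast
qed

text \<open>The signs of the estimate serve as the tests. At some vertex at least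
  \<open>overlap * D\<close> of them are wrong in expectation; the reverse Markov bound keeps half
  of this with probability \<open>overlap / 2\<close>, and each wrong sign costs
  \<open>\<delta>\<^sup>2 / n\<close>.\<close>

lemma cube_loss_bound:
  assumes \<sigma>: "\<sigma> > 0" and \<delta>: "\<delta> > 0" "\<delta> \<le> \<sigma>" and D: "0 < D" "D \<le> n"
    and g: "g \<in> estimators n"
  obtains S where "\<P>(y in obs_law n \<sigma> (cube_point n D \<delta> S).
    loss n (g y) (cube_point n D \<delta> S) \<ge> overlap / 2 * (\<delta>\<^sup>2 * real D / real n)) \<ge> overlap / 2"
proof -
  note [measurable] = borel_measurable_estimator_component[OF g]
  have E: "{y \<in> space (Rn n). 0 \<le> g y i} \<in> sets (Rn n)" if "i < D" for i
    using that D by (auto intro!: borel_measurable_le)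
  obtain S where S: "(\<Sum>i<D. measure (obs_law n \<sigma> (cube_point n D \<delta> S))
    {y \<in> space (Rn n). (y \<in> {y \<in> space (Rn n). 0 \<le> g y i}) \<noteq> (i \<in> S)}) \<ge> overlap * real D"
    using cube_testing_bound[OF \<sigma> \<delta> D E] .
  define f where "f = cube_point n D \<delta> S"
  define H where "H i = {y \<in> space (Rn n). (0 \<le> g y i) \<noteq> (i \<in> S)}" for i
  interpret prob_space "obs_law n \<sigma> f" using \<sigma> by (rule prob_space_obs_law)
  have H: "H i \<in> events" if "i < D" for i
    using that D unfolding H_def by (cases "i \<in> S") (simp_all, measurable)
  have "(\<Sum>i\<in>{..<D}. prob (H i)) \<ge> overlap * real (card {..<D})"
    using S by (simp add: f_def H_def cong: conj_cong)
  then have "overlap / 2 \<le> \<P>(y in obs_law n \<sigma> f.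
      real (card {i \<in> {..<D}. y \<in> H i}) \<ge> overlap / 2 * real (card {..<D}))"
    using D H overlap_pos by (intro reverse_Markov_count) auto
  also have "\<dots> \<le> \<P>(y in obs_law n \<sigma> f. loss n (g y) f \<ge> overlap / 2 * (\<delta>\<^sup>2 * real D / real n))"
  proof (rule finite_measure_mono)
    show "{y \<in> space (obs_law n \<sigma> f). overlap / 2 * (\<delta>\<^sup>2 * real D / real n) \<le> loss n (g y) f} \<in> events"
      using borel_measurable_loss[OF g] by simp
    show "{y \<in> space (obs_law n \<sigma> f). real (card {i \<in> {..<D}. y \<in> H i}) \<ge> overlap / 2 * real (card {..<D})}
      \<subseteq> {y \<in> space (obs_law n \<sigma> f). overlap / 2 * (\<delta>\<^sup>2 * real D / real n) \<le> loss n (g y) f}"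
    proof safe
      fix y assume y: "y \<in> space (obs_law n \<sigma> f)"
        and c: "real (card {i \<in> {..<D}. y \<in> H i}) \<ge> overlap / 2 * real (card {..<D})"
      have "overlap / 2 * (\<delta>\<^sup>2 * real D / real n) = \<delta>\<^sup>2 / real n * (overlap / 2 * real (card {..<D}))"
        by (simp add: field_simps)
      also have "\<dots> \<le> \<delta>\<^sup>2 / real n * real (card {i \<in> {..<D}. y \<in> H i})"
        using c by (intro mult_left_mono) auto
      also have "\<dots> = \<delta>\<^sup>2 / real n * real (card {i \<in> {..<D}. (0 \<le> g y i) \<noteq> (i \<in> S)})"
        using y by (simp add: H_def)
      also have "\<dots> \<le> loss n (g y) f"
        unfolding f_def using D \<delta> by (intro loss_cube_point_ge) auto
      finally show "overlap / 2 * (\<delta>\<^sup>2 * real D / real n) \<le> loss n (g y) f" .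
    qed
  qed
  finally show ?thesis using that unfolding f_def by blast
qed

section \<open>The collection of scaled unit vectors\<close>

definition axis_collection :: "nat \<Rightarrow> nat \<Rightarrow> real \<Rightarrow> affine list"
  where "axis_collection M D \<beta> =
    map (\<lambda>j. (0, \<lambda>i. if j < D \<and> i = j then \<beta> else 0)) [0..<M]"

lemma sum_fun_apply:
  fixes f :: "'a \<Rightarrow> 'b \<Rightarrow> 'c :: comm_monoid_add"
  shows "(\<Sum>i\<in>I. f i) x = (\<Sum>i\<in>I. f i x)"
  by (induction I rule: infinite_finite_induct) simp_all

lemma combine_axis_collection:
  assumes "D \<le> M"
  shows "combine (axis_collection M D \<beta>) w = (0, \<lambda>i. if i < D then \<beta> * w i else 0)"
proof -
  let ?b = "\<lambda>j i. if j < D \<and> i = j then \<beta> else 0"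
  have "combine (axis_collection M D \<beta>) w = (\<Sum>j<M. (0, w j *\<^sub>R ?b j))"
    by (simp add: combine_def axis_collection_def)
  also have "\<dots> = (0, \<Sum>j<M. w j *\<^sub>R ?b j)"
    by (simp add: prod_eq_iff fst_sum snd_sum)
  also have "(\<Sum>j<M. w j *\<^sub>R ?b j) = (\<lambda>i. if i < D then \<beta> * w i else 0)"
  proof
    fix i
    have "(\<Sum>j<M. w j *\<^sub>R ?b j) i = (\<Sum>j<M. w j *\<^sub>R ?b j i)" by (simp add: sum_fun_apply)
    also have "\<dots> = (\<Sum>j<M. if i = j then if i < D then \<beta> * w i else 0 else 0)"
      by (rule sum.cong) auto
    also have "\<dots> = (if i < D then \<beta> * w i else 0)" using assms by simp
    finally show "(\<Sum>j<M. w j *\<^sub>R ?b j) i = (if i < D then \<beta> * w i else 0)" .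
  qed
  finally show ?thesis .
qed

text \<open>The unit vectors \<open>v j\<close> with zero matrix form a basis of the coefficient
  space: the nonzero scale \<open>\<beta>\<close> does not change the span, and the padding adds
  nothing to it.\<close>

lemma dim_coeff_space_axis_collection:
  assumes "D \<le> M" "\<beta> \<noteq> 0"
  shows "dim (coeff_space (axis_collection M D \<beta>)) = D"
proof -
  define v :: "nat \<Rightarrow> affine" where "v j = (0, \<lambda>i. if i = j then 1 else 0)" for j
  have v_eq: "v i = v j \<Longrightarrow> i = j" for i j
    by (auto simp: v_def fun_eq_iff split: if_splits)
  \<comment> \<open>A combination of the \<open>v j\<close> displays its own coefficients, which
    yields both independence and the comparison with \<open>combine\<close>.\<close>
  have comb: "(\<Sum>j<D. c j *\<^sub>R v j) = (0, \<lambda>i. if i < D then c i else 0)" for c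
    by (simp add: v_def prod_eq_iff fst_sum snd_sum fun_eq_iff sum_fun_apply if_distrib[of "\<lambda>x. c _ * x"] cong: if_cong)
  have inj: "inj_on v {..<D}" using v_eq by (auto intro: inj_onI)
  have indep: "independent (v ` {..<D})"
  proof (rule real_vector.independent_if_scalars_zero)
    fix c x assume "(\<Sum>x\<in>v ` {..<D}. c x *\<^sub>R x) = 0" and x: "x \<in> v ` {..<D}"
    then have "(0, \<lambda>i. if i < D then c (v i) else 0) = (0 :: affine)"
      using inj by (simp add: sum.reindex comb[symmetric])
    with x show "c x = 0" by (auto simp: zero_prod_def fun_eq_iff split: if_splits)
  qed simp
  have "coeff_space (axis_collection M D \<beta>) = span (v ` {..<D})"
  proof (intro equalityI subsetI)
    fix x assume "x \<in> coeff_space (axis_collection M D \<beta>)"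
    then obtain w where "x = (\<Sum>j<D. (\<beta> * w j) *\<^sub>R v j)"
      using assms by (auto simp: coeff_space_def combine_axis_collection comb)
    then show "x \<in> span (v ` {..<D})"
      by (simp only:) (intro span_sum span_scale span_base imageI)
  next
    fix x assume "x \<in> span (v ` {..<D})"
    then obtain c where "x = (\<Sum>a\<in>v ` {..<D}. c a *\<^sub>R a)"
      by (auto simp: span_finite)
    then have "x = (\<Sum>j<D. c (v j) *\<^sub>R v j)" using inj by (simp add: sum.reindex)
    then have "x = combine (axis_collection M D \<beta>) (\<lambda>j. c (v j) / \<beta>)"
      using assms by (simp add: combine_axis_collection comb fun_eq_iff)
    then show "x \<in> coeff_space (axis_collection M D \<beta>)" by (auto simp: coeff_space_def)
  qed
  then show ?thesis
    using indep inj by (simp add: dim_eq_card_independent card_image)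
qed

text \<open>The scale is \<open>B * sqrt n\<close> because \<open>norm_n\<close> divides the
  Euclidean norm by \<open>sqrt n\<close>; each nonzero vector then has norm exactly
  \<open>B\<close>.\<close>

lemma axis_collection_mem_collections:
  assumes "D \<le> M" "D \<le> n" "0 < D" "A \<ge> 0" "B > 0"
  shows "axis_collection M D (B * sqrt (real n)) \<in> collections n s M D A B"
proof -
  let ?\<beta> = "B * sqrt (real n)"
  have op: "op_norm n 0 = 0"
  proof -
    have "op_norm n 0 = (SUP x \<in> space (Rn n). (0::real))"
      by (simp add: op_norm_def mat_vec_def enorm_def L2_set_def)
    also have "\<dots> = 0" by (rule cSUP_const) (simp add: space_PiM PiE_eq_empty_iff)
    finally show ?thesis .
  qed
  have b: "norm_n n (\<lambda>i. if j < D \<and> i = j then ?\<beta> else 0) \<le> B" for j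
  proof (rule power2_le_imp_le)
    have "(\<Sum>i<n. (if j < D \<and> i = j then ?\<beta> else 0)\<^sup>2) = (\<Sum>i<n. if i = j then (if j < D then ?\<beta>\<^sup>2 else 0) else 0)"
      by (rule sum.cong) auto
    also have "\<dots> \<le> B\<^sup>2 * n" by (simp add: power_mult_distrib)
    finally show "(norm_n n (\<lambda>i. if j < D \<and> i = j then ?\<beta> else 0))\<^sup>2 \<le> B\<^sup>2"
      using assms by (simp add: norm_n_squared divide_le_eq)
  qed (use assms in simp)
  have "matrix_space (axis_collection M D ?\<beta>) \<subseteq> {0}"
    using assms by (auto simp: matrix_space_def coeff_space_def combine_axis_collection)
  then have "matrix_space (axis_collection M D ?\<beta>) - {0} = {}" by auto
  then have rank: "min_stable_rank n (axis_collection M D ?\<beta>) \<ge> ereal s"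
    unfolding min_stable_rank_def by (simp only: image_empty Inf_empty top_greatest)
  have "set (axis_collection M D ?\<beta>) \<subseteq> matrices n \<times> vectors n"
    using assms by (auto simp: axis_collection_def matrices_def vectors_def)
  moreover have "\<forall>(A\<^sub>j, b\<^sub>j) \<in> set (axis_collection M D ?\<beta>). op_norm n A\<^sub>j \<le> A \<and> norm_n n b\<^sub>j \<le> B"
    using assms op b by (auto simp: axis_collection_def)
  ultimately show ?thesis
    using rank dim_coeff_space_axis_collection[of D M ?\<beta>] assms
    by (simp add: collections_def axis_collection_def)
qed

text \<open>With zero matrices the combined estimate ignores the data, and dividing the signs by
  \<open>\<beta>\<close> cancels the scale. One weight serves all \<open>y\<close>, as is needed to
  make the oracle risk vanish and not only the oracle loss.\<close>

lemma axis_collection_exact: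
  assumes "D \<le> M" "D \<le> n" "\<beta> \<noteq> 0"
  shows "\<exists>w. \<forall>y. affine_est n (axis_collection M D \<beta>) w y = cube_point n D \<delta> S"
proof (intro exI allI)
  fix y
  show "affine_est n (axis_collection M D \<beta>) (\<lambda>j. (if j \<in> S then \<delta> else - \<delta>) / \<beta>) y =
    cube_point n D \<delta> S"
    using assms by (auto simp: affine_est_def combine_axis_collection mat_vec_def cube_point_def fun_eq_iff)
qed

section \<open>The lower bounds in probability and in risk\<close>

theorem theorem4:
  shows "\<exists>c\<^sub>1 c\<^sub>2 :: real. c\<^sub>1 > 0 \<and> c\<^sub>2 > 0 \<and>
    (\<forall>(n::nat) (\<sigma>::real) (F::real) (A::real) (B::real) (M::nat) (D::nat) (s::real).
      \<sigma> > 0 \<and> F > 0 \<and> A \<ge> 1 \<and> B > 0 \<and> 2 \<le> D \<and> D \<le> M \<and> D \<le> n \<and> s \<ge> 1 \<longrightarrow>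
      (\<exists>\<M>\<^sub>0 \<in> collections n s M D A B.
        (INF g \<in> estimators n. SUP f \<in> mean_ball n F.
          \<P>(y in obs_law n \<sigma> f.
            loss n (g y) f - (INF w. loss n (affine_est n \<M>\<^sub>0 w y) f)
              \<ge> c\<^sub>1 * min (F\<^sup>2) (\<sigma>\<^sup>2 * real D / real n))) \<ge> c\<^sub>2 \<and>
        (INF g \<in> estimators n. SUP f \<in> mean_ball n F.
          risk n \<sigma> g f - (INF w. risk n \<sigma> (affine_est n \<M>\<^sub>0 w) f))
            \<ge> ereal (c\<^sub>1 * min (F\<^sup>2) (\<sigma>\<^sup>2 * real D / real n))))"
\<comment> \<open>\<open>overlap\<^sup>2 / 4\<close> is the loss factor \<open>overlap / 2\<close>
  times the probability \<open>overlap / 2\<close>, which is what Markov's inequality gives for the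
  risk.\<close>
proof (rule exI[of _ "overlap\<^sup>2 / 4"], rule exI[of _ "overlap / 2"], intro conjI allI impI, goal_cases)
  case (3 n \<sigma> F A B M D s)
  define p where "p = overlap"
  have p: "0 < p" "p \<le> 1" using overlap_pos overlap_le_1 by (simp_all add: p_def)
  define r where "r = min (F\<^sup>2) (\<sigma>\<^sup>2 * real D / real n)"
  have \<sigma>: "\<sigma> > 0" and D: "0 < D" "D \<le> n" "D \<le> M" and n: "n > 0" and F: "F > 0"
    using 3 by auto
  \<comment> \<open>With this side length every vertex has squared norm \<open>r\<close>. The first
    term of the minimum keeps the vertices in the ball, the second keeps \<delta> below
    \<sigma>.\<close>
  define \<delta> where "\<delta> = sqrt (r * real n / real D)"
  have r: "r > 0" using \<sigma> D n F by (simp add: r_def)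
  have \<delta>2: "\<delta>\<^sup>2 * real D / real n = r"
    using r D n by (simp add: \<delta>_def)
  have \<delta>: "\<delta> > 0" using r D n by (simp add: \<delta>_def)
  have "r \<le> \<sigma>\<^sup>2 * real D / real n" by (simp add: r_def)
  then have "r * real n / real D \<le> \<sigma>\<^sup>2" using D n by (simp add: field_simps)
  then have \<delta>\<sigma>: "\<delta> \<le> \<sigma>" using \<sigma> unfolding \<delta>_def by (intro real_le_lsqrt) auto
  define \<M> where "\<M> = axis_collection M D (B * sqrt (real n))"
  have \<M>: "\<M> \<in> collections n s M D A B"
    unfolding \<M>_def using 3 by (intro axis_collection_mem_collections) auto
  define f where "f = cube_point n D \<delta>"
  have ball: "f S \<in> mean_ball n F" for S
  proof -
    have "(\<Sum>i<n. (f S i)\<^sup>2) = (\<Sum>i\<in>{..<n} \<inter> {..<D}. \<delta>\<^sup>2)"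
      by (subst sum.inter_restrict) (auto intro!: sum.cong simp: f_def cube_point_def)
    also have "{..<n} \<inter> {..<D} = {..<D}" using D by auto
    finally have "(norm_n n (f S))\<^sup>2 = r" using \<delta>2 by (simp add: norm_n_squared mult.commute)
    then have "(norm_n n (f S))\<^sup>2 \<le> F\<^sup>2" by (simp only: r_def min.cobounded1)
    then have "norm_n n (f S) \<le> F" by (rule power2_le_imp_le) (use F in simp)
    then show ?thesis by (simp add: mean_ball_def f_def cube_point_def space_PiM)
  qed
  have exact: "\<exists>w. \<forall>y. affine_est n \<M> w y = f S" for S
    unfolding \<M>_def f_def using D 3 n by (intro axis_collection_exact) simp_all
  have INF_loss: "(INF w. loss n (affine_est n \<M> w y) (f S)) = 0" for y S
  proof (rule antisym)
    obtain w where "affine_est n \<M> w y = f S" using exact by blast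
    then have "loss n (affine_est n \<M> w y) (f S) = 0" by (simp add: loss_eq)
    then show "(INF w. loss n (affine_est n \<M> w y) (f S)) \<le> 0"
      by (intro cINF_lower2[where x = w]) (auto intro: bdd_belowI2 loss_nonneg)
  qed (auto intro: cINF_greatest loss_nonneg)
  have INF_risk: "(INF w. risk n \<sigma> (affine_est n \<M> w) (f S)) = 0" for S
  proof (rule antisym)
    obtain w where "\<And>y. affine_est n \<M> w y = f S" using exact by blast
    then have "risk n \<sigma> (affine_est n \<M> w) (f S) = 0" by (simp add: risk_def loss_eq zero_ennreal.rep_eq)
    then show "(INF w. risk n \<sigma> (affine_est n \<M> w) (f S)) \<le> 0"
      by (intro INF_lower2[where i = w]) auto
  qed (auto intro!: INF_greatest simp: risk_def)
  \<comment> \<open>The infimum in the probability bound is taken in the reals, where a lower bound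
    on it requires a nonempty index set; the identity is an estimator.\<close>
  have est: "estimators n \<noteq> {}" unfolding estimators_def using measurable_ident by blast
  have lower: "\<exists>S. \<P>(y in obs_law n \<sigma> (f S). loss n (g y) (f S) \<ge> p / 2 * r) \<ge> p / 2"
    if g: "g \<in> estimators n" for g
    using cube_loss_bound[OF \<sigma> \<delta> \<delta>\<sigma> D(1,2) g] unfolding f_def \<delta>2 p_def by blast
  \<comment> \<open>Since \<open>p \<le> 1\<close>, the constant dictated by the risk bound also
    serves as threshold in the probability bound.\<close>
  have le: "p\<^sup>2 / 4 * r \<le> p / 2 * r"
    using p r by (intro mult_right_mono) (auto simp: power2_eq_square intro: mult_mono)
  show ?case
  proof (rule bexI[OF _ \<M>], intro conjI, goal_cases)
    case 1
    show ?case
    proof (rule cINF_greatest[OF est])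
      fix g assume g: "g \<in> estimators n"
      obtain S where S: "\<P>(y in obs_law n \<sigma> (f S). loss n (g y) (f S) \<ge> p / 2 * r) \<ge> p / 2"
        using lower[OF g] by blast
      interpret prob_space "obs_law n \<sigma> (f S)" using \<sigma> by (rule prob_space_obs_law)
      note [measurable] = borel_measurable_loss[OF g]
      have "p / 2 \<le> \<P>(y in obs_law n \<sigma> (f S). loss n (g y) (f S) \<ge> p\<^sup>2 / 4 * r)"
        by (intro order_trans[OF S] finite_measure_mono) (blast intro: order_trans[OF le], simp)
      \<comment> \<open>Probabilities are bounded by 1, so the real supremum dominates its value at
        the vertex; the oracle loss there is zero.\<close>
      also have "\<dots> \<le> (SUP f \<in> mean_ball n F. \<P>(y in obs_law n \<sigma> f.
            loss n (g y) f - (INF w. loss n (affine_est n \<M> w y) f) \<ge> p\<^sup>2 / 4 * r))"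
        by (rule cSUP_upper2[OF _ ball[of S]])
          (auto simp: INF_loss intro!: bdd_aboveI2[of _ _ 1] prob_space.prob_le_1 prob_space_obs_law \<sigma>)
      finally show "overlap / 2 \<le> (SUP f \<in> mean_ball n F. \<P>(y in obs_law n \<sigma> f.
            loss n (g y) f - (INF w. loss n (affine_est n \<M> w y) f) \<ge>
              overlap\<^sup>2 / 4 * min (F\<^sup>2) (\<sigma>\<^sup>2 * real D / real n)))"
        unfolding p_def r_def .
    qed
  next
    case 2
    show ?case
    proof (rule INF_greatest)
      fix g assume g: "g \<in> estimators n"
      obtain S where S: "\<P>(y in obs_law n \<sigma> (f S). loss n (g y) (f S) \<ge> p / 2 * r) \<ge> p / 2"
        using lower[OF g] by blast
      interpret prob_space "obs_law n \<sigma> (f S)" using \<sigma> by (rule prob_space_obs_law)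
      note [measurable] = borel_measurable_loss[OF g]
      define G where "G = {y \<in> space (obs_law n \<sigma> (f S)). loss n (g y) (f S) \<ge> p / 2 * r}"
      have G: "G \<in> events" by (simp add: G_def)
      \<comment> \<open>Markov's inequality: the loss is at least \<open>p / 2 * r\<close> on
        \<open>G\<close>, an event of probability at least \<open>p / 2\<close>.\<close>
      have "ennreal (p\<^sup>2 / 4 * r) = ennreal (p / 2 * r) * ennreal (p / 2)"
        using p r by (simp add: ennreal_mult[symmetric] power2_eq_square)
      also have "\<dots> \<le> ennreal (p / 2 * r) * emeasure (obs_law n \<sigma> (f S)) G"
        using S by (intro mult_left_mono) (auto simp: emeasure_eq_measure G_def intro: ennreal_leI)
      also have "\<dots> = (\<integral>\<^sup>+ y. ennreal (p / 2 * r) * indicator G y \<partial>obs_law n \<sigma> (f S))"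
        using G by (simp add: nn_integral_cmult_indicator)
      also have "\<dots> \<le> (\<integral>\<^sup>+ y. ennreal (loss n (g y) (f S)) \<partial>obs_law n \<sigma> (f S))"
        by (intro nn_integral_mono) (auto simp: G_def intro: ennreal_leI split: split_indicator)
      finally have "ereal (p\<^sup>2 / 4 * r) \<le> risk n \<sigma> g (f S)"
        using p r unfolding risk_def by (simp add: less_eq_ennreal.rep_eq)
      \<comment> \<open>The oracle risk is 0 at this vertex, so the extended real difference is the
        risk itself even when that is infinite.\<close>
      also have "\<dots> = risk n \<sigma> g (f S) - (INF w. risk n \<sigma> (affine_est n \<M> w) (f S))"
        by (simp add: INF_risk)
      also have "\<dots> \<le> (SUP f \<in> mean_ball n F.
          risk n \<sigma> g f - (INF w. risk n \<sigma> (affine_est n \<M> w) f))"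
        by (rule SUP_upper[OF ball])
      finally show "ereal (overlap\<^sup>2 / 4 * min (F\<^sup>2) (\<sigma>\<^sup>2 * real D / real n)) \<le> (SUP f \<in> mean_ball n F.
          risk n \<sigma> g f - (INF w. risk n \<sigma> (affine_est n \<M> w) f))"
        unfolding p_def r_def .
    qed
  qed
qed (use overlap_pos in auto)

end
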